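(* Consider the model, the truncated Markov chain and the parameter restrictions described in the context, and assume that whenever the shock is in its absorbing state the economy is in the unintended steady state $[c^u\ \pi^u]$ (expressed in deviations from the intended steady state), so that $\pi^u<\bar\pi<0$. Let $p\in[0,1]$. Then: 1. For each $d\in[0,d^{max}]$ and each finite maximum horizon $\ell\geq1$, there exists a unique equilibrium sequence $\{c_{t+k},\pi_{t+k}\}_{k\geq0}$ that solves the Euler equation, the Phillips curve and the Taylor rule. 2. Given this terminal condition there exists neither a normal-time solution (type N) nor a switching solution (type S); the equilibrium is always an ELB solution (type L). 3. For $d>0$, the ELB solution is stable if $p<\bar p$ and unstable otherwise.
   Context: Parameters: $\sigma,\kappa,\eta,\psi,\mu>0$, $\beta\in(0,1)$, $\bar c\in(0,1)$, $m_{xx},m_{x\pi},m_{\pi\pi}\in(0,1]$; $d^{max}>0$ is a fixed upper bound on the shock size. Write $K:=\kappa(1+\eta\bar c)$ and $\bar\pi:=-\mu/\psi$. It is assumed that $$\psi>m_{x\pi}+\frac{(1-m_{xx})(\beta m_{\pi\pi}-1)}{K\sigma}$$ and that $F_L(1)<0$, where $F_L(p):=(1-pm_{xx})(1-p\beta m_{\pi\pi})-p\sigma Km_{x\pi}$. The threshold $\bar p$ is the unique root of $F_L$ in $(0,1)$. Model (no government spending): for each date $t$, $$c_t=m_{xx}\mathbb{E}_tc_{t+1}-\sigma(i_t-m_{x\pi}\mathbb{E}_t\pi_{t+1}+d_t)\ \text{(Euler)},\quad \pi_t=m_{\pi\pi}\beta\,\mathbb{E}_t\pi_{t+1}+Kc_t\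 \text{(Phillips curve)},\quad i_t=\max\{\psi\pi_t,-\mu\}\ \text{(Taylor rule)}.$$ Unintended steady state: the constant solution $(c^u,\pi^u)$ of the model with $d_t=0$ at which the ELB binds ($i=-\mu$), i.e. $c^u=m_{xx}c^u+\sigma\mu+\sigma m_{x\pi}\pi^u$ and $\pi^u=\beta m_{\pi\pi}\pi^u+Kc^u$; under the parameter restrictions it satisfies $\pi^u<\bar\pi<0$. Truncated Markov chain: at date $t$ the shock starts in the low state, $d_t=d$. In periods $t,\dots,t+\ell-1$, from the low state (value $d$) it stays there with probability $p$ and moves to the absorbing state (value $0$) with probability $1-p$; the absorbing state is never left. If still in the low state at $t+\ell-1$, it jumps deterministically to the absorbing state at $t+\ell$. $\tilde c_{t+n}(\ell),\tilde\pi_{t+n}(\ell)$, $n=0,\dots,\ell-1$, denote consumption and inflation at $t+n$ conditional on the shock still being in the low state. With the unintended steady state as terminal condition, conditional expectations at $t+n$ in the low state are $\mathbb{E}_{t+n}x_{t+n+1}=p\tilde x_{t+n+1}(\ell)+(1-p)x^u$ for $n<\ell-1$ and $\mathbb{E}_{t+\ell-1}x_{t+\ell}=x^u$, $x\in\{c,\pi\}$. Solution types: type N (normal time) if $\tilde\pi_{t+n}(\ell)>\bar\pi$ for all $n=0,\dots,\ell-1$; type L (ELB) if $\tilde\pi_{t+n}(\ell)\leq\bar\pi$ for all $n=0,\dots,\ell-1$; type S (switching) if there is $k\in\{0,\dots,\ell-2\}$ with $\tilde\pi_{t+n}(\ell)\leq\bar\pi$ for $n=0,\dots,k$ and $\tilde\pi_{t+n}(\ell)>\bar\pi$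 for $n=k+1,\dots,\ell-1$. Stability (for fixed $p,d$): the solution is stable if $\tilde\pi_t(\ell)$ converges to a finite limit as $\ell\to\infty$, and unstable if $|\tilde\pi_t(\ell)|\to\infty$ as $\ell\to\infty$. *)

theory Defs
  imports "HOL-Probability.Probability_Mass_Function"
begin

section \<open>Parameters\<close>

record nk_params =
  sigm :: real
  kappa :: real
  eta :: real
  psi :: real
  mu :: real
  beta :: real
  cbar :: real
  mxx :: real
  mxpi :: real
  mpipi :: real

definition KK :: "nk_params \<Rightarrow> real" where
  "KK P = kappa P * (1 + eta P * cbar P)"

text \<open>Inflation threshold below which the effective lower bound (ELB) binds.\<close>

definition pi_bar :: "nk_params \<Rightarrow> real" where
  "pi_bar P = - mu P / psi P"

definition F_L :: "nk_params \<Rightarrow> real \<Rightarrow> real" where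
  "F_L P p = (1 - p * mxx P) * (1 - p * beta P * mpipi P) - p * sigm P * KK P * mxpi P"

definition valid_params :: "nk_params \<Rightarrow> bool" where
  "valid_params P \<longleftrightarrow>
     sigm P > 0 \<and> kappa P > 0 \<and> eta P > 0 \<and> psi P > 0 \<and> mu P > 0 \<and>
     beta P \<in> {0<..<1} \<and> cbar P \<in> {0<..<1} \<and>
     mxx P \<in> {0<..1} \<and> mxpi P \<in> {0<..1} \<and> mpipi P \<in> {0<..1} \<and>
     psi P > mxpi P + (1 - mxx P) * (beta P * mpipi P - 1) / (KK P * sigm P) \<and>
     F_L P 1 < 0"

text \<open>Well defined for valid parameters, see \<open>F_L_root_ex1\<close> below.\<close>

definition p_bar :: "nk_params \<Rightarrow> real" where
  "p_bar P = (THE p. p \<in> {0<..<1} \<and> F_L P p = 0)"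


section \<open>Model equations\<close>

text \<open>\<open>Ec\<close> and \<open>Epi\<close> are the conditional expectations of next period's consumption and
  inflation.\<close>

definition euler :: "nk_params \<Rightarrow> real \<Rightarrow> real \<Rightarrow> real \<Rightarrow> real \<Rightarrow> real \<Rightarrow> bool" where
  "euler P c Ec i Epi d \<longleftrightarrow> c = mxx P * Ec - sigm P * (i - mxpi P * Epi + d)"

definition phillips :: "nk_params \<Rightarrow> real \<Rightarrow> real \<Rightarrow> real \<Rightarrow> bool" where
  "phillips P infl Epi c \<longleftrightarrow> infl = mpipi P * beta P * Epi + KK P * c"

definition taylor :: "nk_params \<Rightarrow> real \<Rightarrow> real" where
  "taylor P infl = max (psi P * infl) (- mu P)"

definition unintended_ss :: "nk_params \<Rightarrow> real \<Rightarrow> real \<Rightarrow> bool" where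
  "unintended_ss P cu piu \<longleftrightarrow>
     euler P cu cu (taylor P piu) piu 0 \<and> phillips P piu piu cu \<and> taylor P piu = - mu P"


section \<open>The truncated Markov chain\<close>

datatype shock_state = Low | Absorbing

fun shock :: "real \<Rightarrow> shock_state \<Rightarrow> real" where
  "shock d Low = d"
| "shock d Absorbing = 0"

text \<open>Dates are counted from the initial date \<open>t\<close>. \<open>transition p l n s\<close> is the distribution of
  the state at date \<open>t + n + 1\<close>, given state \<open>s\<close> at date \<open>t + n\<close>, for maximum horizon \<open>l\<close>.\<close>

fun transition :: "real \<Rightarrow> nat \<Rightarrow> nat \<Rightarrow> shock_state \<Rightarrow> shock_state pmf" where
  "transition p l n Absorbing = return_pmf Absorbing"
| "transition p l n Low =
     (if Suc n < l then map_pmf (\<lambda>stay. if stay then Low else Absorbing) (bernoulli_pmf p)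
      else return_pmf Absorbing)"

text \<open>The date-state pairs of the chain: it starts in \<open>Low\<close> and has left \<open>Low\<close> at \<open>t + l\<close> at the
  latest. For \<open>p = 0\<close> and \<open>p = 1\<close> some of them have probability zero; they are kept because the
  low-state path is defined conditionally on the shock still being low.\<close>

fun node :: "nat \<Rightarrow> nat \<Rightarrow> shock_state \<Rightarrow> bool" where
  "node l n Low \<longleftrightarrow> n < l"
| "node l n Absorbing \<longleftrightarrow> 1 \<le> n"


section \<open>Equilibria\<close>

text \<open>A state-contingent sequence assigns a value to each date and each current shock state. As the
  absorbing-state values are pinned down by the terminal condition and there is only one history
  ending in \<open>Low\<close> at a given date, this is no restriction compared with dependence on the
  entire shock history.\<close>

type_synonym process = "nat \<Rightarrow> shock_state \<Rightarrow> real"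

definition cond_exp :: "real \<Rightarrow> nat \<Rightarrow> process \<Rightarrow> nat \<Rightarrow> shock_state \<Rightarrow> real" where
  "cond_exp p l x n s = measure_pmf.expectation (transition p l n s) (x (Suc n))"

definition equilibrium ::
    "nk_params \<Rightarrow> real \<Rightarrow> real \<Rightarrow> real \<Rightarrow> real \<Rightarrow> nat \<Rightarrow> process \<Rightarrow> process \<Rightarrow> bool" where
  "equilibrium P cu piu p d l c infl \<longleftrightarrow>
     (\<forall>n s. node l n s \<longrightarrow>
        euler P (c n s) (cond_exp p l c n s) (taylor P (infl n s)) (cond_exp p l infl n s)
          (shock d s) \<and>
        phillips P (infl n s) (cond_exp p l infl n s) (c n s)) \<and>
     (\<forall>n. node l n Absorbing \<longrightarrow> c n Absorbing = cu \<and> infl n Absorbing = piu)"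

definition type_N :: "nk_params \<Rightarrow> nat \<Rightarrow> process \<Rightarrow> bool" where
  "type_N P l infl \<longleftrightarrow> (\<forall>n<l. infl n Low > pi_bar P)"

definition type_L :: "nk_params \<Rightarrow> nat \<Rightarrow> process \<Rightarrow> bool" where
  "type_L P l infl \<longleftrightarrow> (\<forall>n<l. infl n Low \<le> pi_bar P)"

text \<open>The switching date \<open>k\<close> ranges over \<open>{0..l-2}\<close>, which is empty for \<open>l = 1\<close>.\<close>

definition type_S :: "nk_params \<Rightarrow> nat \<Rightarrow> process \<Rightarrow> bool" where
  "type_S P l infl \<longleftrightarrow>
     (\<exists>k. k + 2 \<le> l \<and> (\<forall>n\<le>k. infl n Low \<le> pi_bar P) \<and> (\<forall>n. k < n \<and> n < l \<longrightarrow> infl n Low > pi_bar P))"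

text \<open>Stability concerns the initial low-state inflation rate as a function of the maximum horizon,
  so the argument is a family of inflation processes indexed by that horizon.\<close>

definition stable_solution :: "(nat \<Rightarrow> process) \<Rightarrow> bool" where
  "stable_solution infl \<longleftrightarrow> (\<exists>L. (\<lambda>l. infl l 0 Low) \<longlonglongrightarrow> L)"

definition unstable_solution :: "(nat \<Rightarrow> process) \<Rightarrow> bool" where
  "unstable_solution infl \<longleftrightarrow> filterlim (\<lambda>l. \<bar>infl l 0 Low\<bar>) at_top sequentially"


section \<open>Well-definedness\<close>

lemma F_L_root_ex1:
  assumes "valid_params P"
  shows "\<exists>!p. p \<in> {0<..<1} \<and> F_L P p = 0"
proof -
  have F1: "F_L P 1 < 0" using assms by (simp add: valid_params_def)
  have F0: "F_L P 0 = 1" by (simp add: F_L_def)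
  have "continuous_on {0..1} (F_L P)" unfolding F_L_def by (intro continuous_intros)
  then obtain r where r: "0 \<le> r" "r \<le> 1" "F_L P r = 0"
    using IVT2'[of "F_L P" 1 0 0] F0 F1 by auto
  have r': "r \<in> {0<..<1}" using r F0 F1 by (cases "r = 0"; cases "r = 1") auto
  define a where "a = mxx P * beta P * mpipi P"
  define b where "b = - (mxx P + beta P * mpipi P + sigm P * KK P * mxpi P)"
  have a: "a > 0" using assms by (simp add: valid_params_def a_def)
  have F: "F_L P p = a * p\<^sup>2 + b * p + 1" for p
    by (simp add: F_L_def a_def b_def power2_eq_square algebra_simps)
  have uniq: "s = q" if "s \<in> {0<..<1}" "q \<in> {0<..<1}" "F_L P s = 0" "F_L P q = 0" for s q
  proof (rule ccontr)
    assume "s \<noteq> q"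
    have "(s - q) * (a * (s + q) + b) = F_L P s - F_L P q"
      by (simp add: F power2_eq_square algebra_simps)
    then have b: "b = - a * (s + q)" using that \<open>s \<noteq> q\<close> by simp
    have "F_L P 1 = F_L P 1 - F_L P s" using that by simp
    also have "\<dots> = a * (1 - s) * (1 - q)" by (simp add: F b power2_eq_square algebra_simps)
    also have "\<dots> > 0" using a that by simp
    finally show False using F1 by simp
  qed
  show ?thesis using r r' uniq by blast
qed

lemma KK_pos: "valid_params P \<Longrightarrow> KK P > 0"
  by (auto simp: valid_params_def KK_def intro!: mult_pos_pos add_pos_pos)

lemma unintended_ss_ex1:
  assumes "valid_params P"
  shows "\<exists>!(cu, piu). unintended_ss P cu piu"
    and "unintended_ss P cu piu \<Longrightarrow> piu < pi_bar P"
    and "pi_bar P < 0"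
proof -
  note v = assms[unfolded valid_params_def]
  have K: "KK P > 0" and F1: "F_L P 1 < 0" and pos: "sigm P > 0" "mu P > 0" "psi P > 0"
    using v KK_pos[OF assms] by auto
  define u where "u = KK P * sigm P * mu P / F_L P 1"
  define w where "w = (1 - beta P * mpipi P) * u / KK P"
  have "KK P * sigm P * psi P > KK P * sigm P *
      (mxpi P + (1 - mxx P) * (beta P * mpipi P - 1) / (KK P * sigm P))"
    using v K by (intro mult_strict_left_mono) auto
  also have "KK P * sigm P * (mxpi P + (1 - mxx P) * (beta P * mpipi P - 1) / (KK P * sigm P))
      = - F_L P 1"
    using K pos by (simp add: F_L_def field_simps)
  finally have "KK P * sigm P * psi P * mu P > - F_L P 1 * mu P"
    using pos by (intro mult_strict_right_mono) auto
  then have u: "u < pi_bar P"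
    using F1 pos by (simp add: u_def pi_bar_def field_simps)
  then have taylor_u: "taylor P u = - mu P"
    using pos by (simp add: taylor_def pi_bar_def field_simps)
  have ss: "unintended_ss P cu piu \<longleftrightarrow> cu = w \<and> piu = u" for cu piu
  proof
    assume *: "unintended_ss P cu piu"
    have 1: "cu = mxx P * cu + sigm P * mu P + sigm P * mxpi P * piu"
      using * unfolding unintended_ss_def euler_def by (auto simp: algebra_simps)
    have 2: "KK P * cu = (1 - beta P * mpipi P) * piu"
      using * by (simp add: unintended_ss_def phillips_def algebra_simps)
    have "piu * F_L P 1
        = (1 - mxx P) * ((1 - beta P * mpipi P) * piu) - piu * sigm P * KK P * mxpi P"
      by (simp add: F_L_def algebra_simps)
    also have "\<dots> = KK P * (cu - mxx P * cu - sigm P * mxpi P * piu)"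
      by (simp only: 2[symmetric]) (simp add: algebra_simps)
    also have "cu - mxx P * cu - sigm P * mxpi P * piu = sigm P * mu P"
      using 1 by linarith
    finally have "piu = u" using F1 by (simp add: u_def field_simps)
    moreover have "cu = w" using 2 K \<open>piu = u\<close> by (simp add: w_def field_simps)
    ultimately show "cu = w \<and> piu = u" by simp
  next
    assume *: "cu = w \<and> piu = u"
    have 2: "KK P * w = (1 - beta P * mpipi P) * u" using K by (simp add: w_def)
    have "u * F_L P 1 = KK P * (sigm P * mu P)" using F1 by (simp add: u_def)
    moreover have "u * F_L P 1 = (1 - mxx P) * (KK P * w) - u * sigm P * KK P * mxpi P"
      unfolding 2 by (simp add: F_L_def algebra_simps)
    ultimately have "KK P * ((1 - mxx P) * w - u * sigm P * mxpi P) = KK P * (sigm P * mu P)"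
      by (simp add: algebra_simps)
    then have "(1 - mxx P) * w - u * sigm P * mxpi P = sigm P * mu P" using K by simp
    then show "unintended_ss P cu piu" using * 2 taylor_u
      by (simp add: unintended_ss_def euler_def phillips_def algebra_simps)
  qed
  show "\<exists>!(cu, piu). unintended_ss P cu piu" by (rule ex1I[of _ "(w, u)"]) (auto simp: ss)
  show "piu < pi_bar P" if "unintended_ss P cu piu" using that u by (simp add: ss)
  show "pi_bar P < 0" using pos by (simp add: pi_bar_def)
qed

lemma cond_exp_simps:
  assumes "0 \<le> p" "p \<le> 1"
  shows "Suc n < l \<Longrightarrow> cond_exp p l x n Low = p * x (Suc n) Low + (1 - p) * x (Suc n) Absorbing"
    and "\<not> Suc n < l \<Longrightarrow> cond_exp p l x n Low = x (Suc n) Absorbing"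
    and "cond_exp p l x n Absorbing = x (Suc n) Absorbing"
  using assms by (simp_all add: cond_exp_def)

end

theory Submission
  imports Defs
begin

text \<open>In deviations from the unintended steady state, the ELB regime is a linear recursion in the
  remaining horizon with nonnegative coefficients and a nonpositive forcing term. Deviations are
  therefore nonpositive, so the ELB binds at every low-state date, and in a unique way. They also
  decrease in the horizon, so they converge if bounded below and diverge otherwise. A limit
  \<open>z\<close> of the inflation deviation satisfies \<open>F_L p * z = - K \<sigma> d\<close>, which for \<open>d > 0\<close> has a
  nonpositive solution exactly when \<open>F_L p > 0\<close>, i.e. when \<open>p\<close> is below its threshold.\<close>

section \<open>Sign of \<open>F_L\<close> relative to the threshold\<close>

text \<open>\<open>F_L\<close> falls from 1 at 0 to a negative value at 1, so by the intermediate
  value theorem a wrong sign at \<open>p\<close> would force a root on the wrong side of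
  \<open>p_bar P\<close>, against uniqueness.\<close>

lemma F_L_pos_iff:
  assumes "valid_params P" "p \<in> {0..1}"
  shows "F_L P p > 0 \<longleftrightarrow> p < p_bar P"
proof -
  have r: "p_bar P \<in> {0<..<1} \<and> F_L P (p_bar P) = 0"
    unfolding p_bar_def by (rule theI') (rule F_L_root_ex1[OF assms(1)])
  have uniq: "q = p_bar P" if "q \<in> {0<..<1}" "F_L P q = 0" for q
    using F_L_root_ex1[OF assms(1)] r that by blast
  have F1: "F_L P 1 < 0" using assms(1) by (simp add: valid_params_def)
  have F0: "F_L P 0 = 1" by (simp add: F_L_def)
  have cont: "continuous_on S (F_L P)" for S
    unfolding F_L_def by (intro continuous_intros)
  show ?thesis
  proof
    assume pos: "F_L P p > 0"
    obtain q where q: "p \<le> q" "q \<le> 1" "F_L P q = 0"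
      using IVT2'[of "F_L P" 1 0 p] F1 pos assms(2) cont by auto
    have "q \<noteq> p" "q \<noteq> 1" using q pos F1 by auto
    then show "p < p_bar P" using uniq[of q] q assms(2) by auto
  next
    assume less: "p < p_bar P"
    show "F_L P p > 0"
    proof (rule ccontr)
      assume "\<not> F_L P p > 0"
      then obtain q where q: "0 \<le> q" "q \<le> p" "F_L P q = 0"
        using IVT2'[of "F_L P" p 0 0] F0 assms(2) cont by auto
      have "q \<noteq> 0" using q F0 by auto
      then show False using uniq[of q] q less r by auto
    qed
  qed
qed

section \<open>The ELB recursion and its monotonicity\<close>

text \<open>ELB deviations of low-state consumption and inflation from the unintended steady state,
  indexed by the number of periods left until the shock is sure to be absorbed.\<close>

fun c_gap :: "nk_params \<Rightarrow> real \<Rightarrow> real \<Rightarrow> nat \<Rightarrow> real"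
  and pi_gap :: "nk_params \<Rightarrow> real \<Rightarrow> real \<Rightarrow> nat \<Rightarrow> real" where
  "c_gap P p d 0 = 0"
| "c_gap P p d (Suc j) =
     mxx P * (p * c_gap P p d j) + sigm P * mxpi P * (p * pi_gap P p d j) - sigm P * d"
| "pi_gap P p d 0 = 0"
| "pi_gap P p d (Suc j) = mpipi P * beta P * (p * pi_gap P p d j) + KK P *
     (mxx P * (p * c_gap P p d j) + sigm P * mxpi P * (p * pi_gap P p d j) - sigm P * d)"

text \<open>The definition inlines current consumption so that all recursive calls are at
  \<open>j\<close>; this form restores the Phillips curve.\<close>

lemma pi_gap_Suc_c_gap:
  "pi_gap P p d (Suc j) = mpipi P * beta P * (p * pi_gap P p d j) + KK P * c_gap P p d (Suc j)"
  by simp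

text \<open>The first step down from 0 comes from the forcing term; nonnegative coefficients then
  pass the inequality on to every later step.\<close>

lemma gap_Suc_le:
  assumes "valid_params P" "0 \<le> p" "d \<ge> 0"
  shows "c_gap P p d (Suc j) \<le> c_gap P p d j \<and> pi_gap P p d (Suc j) \<le> pi_gap P p d j"
proof (induction j)
  case 0
  then show ?case
    using assms KK_pos[OF assms(1)] by (auto simp: valid_params_def intro: mult_nonneg_nonneg)
next
  case (Suc j)
  have c: "c_gap P p d (Suc (Suc j)) \<le> c_gap P p d (Suc j)"
    unfolding c_gap.simps(2)[of P p d "Suc j"] c_gap.simps(2)[of P p d j]
    using Suc assms
    by (intro diff_right_mono add_mono mult_left_mono) (auto simp: valid_params_def)
  have "pi_gap P p d (Suc (Suc j)) \<le> pi_gap P p d (Suc j)"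
    unfolding pi_gap_Suc_c_gap[of P p d "Suc j"] pi_gap_Suc_c_gap[of P p d j]
    using Suc c assms KK_pos[OF assms(1)]
    by (intro add_mono mult_left_mono) (auto simp: valid_params_def)
  with c show ?case by simp
qed

lemma gap_nonpos:
  assumes "valid_params P" "0 \<le> p" "d \<ge> 0"
  shows "c_gap P p d j \<le> 0" "pi_gap P p d j \<le> 0"
proof -
  have "decseq (c_gap P p d)" "decseq (pi_gap P p d)"
    using gap_Suc_le[OF assms] by (auto intro: decseq_SucI simp del: c_gap.simps pi_gap.simps)
  from decseqD[OF this(1), of 0 j] decseqD[OF this(2), of 0 j]
  show "c_gap P p d j \<le> 0" "pi_gap P p d j \<le> 0" by simp_all
qed

text \<open>Since the interest rate is at least \<open>- \<mu>\<close>, consumption is at most its ELB value, hence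
  at most \<open>cu\<close>; so inflation is at most \<open>piu\<close>, and the ELB does bind.\<close>

lemma euler_phillips_below_ss_iff:
  assumes "valid_params P" "unintended_ss P cu piu" "d \<ge> 0" "y \<le> 0" "z \<le> 0"
  \<comment> \<open>\<open>y\<close> and \<open>z\<close> are expected deviations from the steady
    state; \<open>g\<close> is the consumption deviation they imply at the rate
    \<open>- mu P\<close>.\<close>
  defines "g \<equiv> mxx P * y + sigm P * mxpi P * z - sigm P * d"
  shows "euler P c (cu + y) (taylor P infl) (piu + z) d \<and> phillips P infl (piu + z) c
    \<longleftrightarrow> c = cu + g \<and> infl = piu + (mpipi P * beta P * z + KK P * g)"
proof -
  note v = assms(1)[unfolded valid_params_def]
  have K: "KK P > 0" by (rule KK_pos[OF assms(1)])
  have cu: "cu = mxx P * cu + sigm P * mu P + sigm P * mxpi P * piu"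
    and piu: "piu = mpipi P * beta P * piu + KK P * cu"
    using assms(2) by (auto simp: unintended_ss_def euler_def phillips_def algebra_simps)
  have signs: "mxx P * y \<le> 0" "sigm P * mxpi P * z \<le> 0" "sigm P * d \<ge> 0" "mpipi P * beta P * z \<le> 0"
    using v assms(3-5) by (auto intro!: mult_nonneg_nonpos)
  then have g: "g \<le> 0" by (simp add: g_def)
  have binds: "taylor P infl = - mu P" if "infl \<le> piu"
  proof -
    have "infl < - mu P / psi P"
      using that unintended_ss_ex1(2)[OF assms(1,2)] by (simp add: pi_bar_def)
    then have "psi P * infl \<le> - mu P" using v by (simp add: field_simps)
    then show ?thesis by (simp add: taylor_def)
  qed
  \<comment> \<open>The last term is a nonnegative penalty that vanishes exactly when the ELB binds,
    so it bounds \<open>c\<close> before the regime is known.\<close>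
  have euler: "euler P c (cu + y) (taylor P infl) (piu + z) d
      \<longleftrightarrow> c = cu + g - sigm P * (taylor P infl + mu P)"
    unfolding euler_def g_def using cu by (auto simp: algebra_simps)
  have phillips: "phillips P infl (piu + z) c
      \<longleftrightarrow> infl = piu + (mpipi P * beta P * z + KK P * (c - cu))"
    unfolding phillips_def using piu by (auto simp: algebra_simps)
  have infl_le: "infl \<le> piu"
    if "c \<le> cu + g" "infl = piu + (mpipi P * beta P * z + KK P * (c - cu))"
  proof -
    have "KK P * (c - cu) \<le> 0" using that g K by (intro mult_nonneg_nonpos) auto
    then show ?thesis using that signs by simp
  qed
  have c_le: "c \<le> cu + g" if "c = cu + g - sigm P * (taylor P infl + mu P)"
  proof -
    have "sigm P * (taylor P infl + mu P) \<ge> 0"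
      using v by (intro mult_nonneg_nonneg) (auto simp: taylor_def)
    then show ?thesis using that by simp
  qed
  show ?thesis unfolding euler phillips
  proof (intro iffI conjI; elim conjE)
    assume c: "c = cu + g - sigm P * (taylor P infl + mu P)"
      and infl: "infl = piu + (mpipi P * beta P * z + KK P * (c - cu))"
    have "taylor P infl = - mu P" by (rule binds[OF infl_le[OF c_le[OF c] infl]])
    then show c': "c = cu + g" using c by simp
    show "infl = piu + (mpipi P * beta P * z + KK P * g)" using infl unfolding c' by simp
  next
    assume c: "c = cu + g" and infl: "infl = piu + (mpipi P * beta P * z + KK P * g)"
    show infl': "infl = piu + (mpipi P * beta P * z + KK P * (c - cu))"
      unfolding c using infl by simp
    have "taylor P infl = - mu P" by (rule binds[OF infl_le[OF _ infl']]) (simp add: c)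
    then show "c = cu + g - sigm P * (taylor P infl + mu P)" using c by simp
  qed
qed

section \<open>Equilibria in closed form\<close>

text \<open>Backward induction from the last low date: each period is solved uniquely given its
  successor. Existence, uniqueness, type and stability are all read off from this form.\<close>

lemma equilibrium_iff:
  assumes "valid_params P" "unintended_ss P cu piu" "p \<in> {0..1}" "d \<ge> 0"
  shows "equilibrium P cu piu p d l c infl \<longleftrightarrow>
      (\<forall>n<l. c n Low = cu + c_gap P p d (l - n) \<and> infl n Low = piu + pi_gap P p d (l - n)) \<and>
      (\<forall>n\<ge>1. c n Absorbing = cu \<and> infl n Absorbing = piu)"
    (is "_ \<longleftrightarrow> ?low \<and> ?abs")
proof -
  have p: "0 \<le> p" "p \<le> 1" using assms(3) by auto
  have abs_eqs: "euler P (c n Absorbing) (cond_exp p l c n Absorbing) (taylor P (infl n Absorbing))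
        (cond_exp p l infl n Absorbing) (shock d Absorbing) \<and>
      phillips P (infl n Absorbing) (cond_exp p l infl n Absorbing) (c n Absorbing)"
    if ?abs "n \<ge> 1" for n
  proof -
    have eqs: "c n Absorbing = cu" "c (Suc n) Absorbing = cu"
        "infl n Absorbing = piu" "infl (Suc n) Absorbing = piu"
      using that by auto
    show ?thesis
      using assms(2) unfolding cond_exp_simps(3)[OF p] eqs shock.simps unintended_ss_def by blast
  qed
  have step: "euler P (c n Low) (cond_exp p l c n Low) (taylor P (infl n Low))
        (cond_exp p l infl n Low) (shock d Low) \<and>
      phillips P (infl n Low) (cond_exp p l infl n Low) (c n Low)
      \<longleftrightarrow> c n Low = cu + c_gap P p d (l - n) \<and> infl n Low = piu + pi_gap P p d (l - n)"
    if ?abs "n < l"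
      \<comment> \<open>Conditional, because the last low date has no low successor.\<close>
      and succ: "Suc n < l \<Longrightarrow> c (Suc n) Low = cu + c_gap P p d (l - Suc n) \<and>
        infl (Suc n) Low = piu + pi_gap P p d (l - Suc n)" for n
  proof -
    have "cond_exp p l c n Low = cu + p * c_gap P p d (l - Suc n) \<and>
        cond_exp p l infl n Low = piu + p * pi_gap P p d (l - Suc n)"
    proof (cases "Suc n < l")
      case True
      then show ?thesis
        using succ that(1) by (simp add: cond_exp_simps[OF p] algebra_simps)
    next
      case False
      \<comment> \<open>A gap of 0 at horizon 0 encodes the sure jump to the steady state, so the
        last low date obeys the same formula.\<close>
      then have "l - Suc n = 0" by simp
      then show ?thesis using False that(1) by (simp add: cond_exp_simps[OF p])
    qed
    moreover have "p * c_gap P p d j \<le> 0" "p * pi_gap P p d j \<le> 0" for j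
      using gap_nonpos[OF assms(1) p(1) assms(4)] p by (auto intro: mult_nonneg_nonpos)
    moreover have "l - n = Suc (l - Suc n)" using that by simp
    ultimately show ?thesis
      using euler_phillips_below_ss_iff[OF assms(1,2,4)] by simp
  qed
  show ?thesis
  proof
    assume eq: "equilibrium P cu piu p d l c infl"
    then have abs: ?abs by (auto simp: equilibrium_def)
    have low: "c n Low = cu + c_gap P p d (l - n) \<and> infl n Low = piu + pi_gap P p d (l - n)"
      if "n < l" for n
      using that
    \<comment> \<open>Inducting on the remaining horizon makes the hypothesis available at the later
      date \<open>Suc n\<close>.\<close>
    proof (induction "l - n" arbitrary: n rule: less_induct)
      case less
      have "Suc n < l \<Longrightarrow> c (Suc n) Low = cu + c_gap P p d (l - Suc n) \<and>
          infl (Suc n) Low = piu + pi_gap P p d (l - Suc n)"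
        by (rule less.hyps) auto
      from step[OF abs less.prems this] show ?case
        using eq less.prems unfolding equilibrium_def by (metis node.simps(1))
    qed
    with abs show "?low \<and> ?abs" by blast
  next
    assume *: "?low \<and> ?abs"
    then have abs: ?abs by blast
    have "euler P (c n s) (cond_exp p l c n s) (taylor P (infl n s)) (cond_exp p l infl n s)
          (shock d s) \<and> phillips P (infl n s) (cond_exp p l infl n s) (c n s)"
      if "node l n s" for n s
    proof (cases s)
      case Low
      then show ?thesis using step[OF abs, of n] * that by simp
    next
      case Absorbing
      then show ?thesis using abs_eqs[OF abs, of n] that by simp
    qed
    then show "equilibrium P cu piu p d l c infl" using abs by (auto simp: equilibrium_def)
  qed
qed

section \<open>Limits of the recursion\<close>

text \<open>Eliminating consumption \<open>y\<close> leaves one linear equation in \<open>z\<close>,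
  whose coefficient is \<open>F_L P p\<close> once the model parameters are inserted.\<close>

lemma pi_gap_fixed_point:
  assumes "z = a * (p * z) + K * y"
    and "y = m * (p * y) + s * x * (p * z) - s * d"
  shows "((1 - p * m) * (1 - p * a) - p * s * K * x) * z = - K * s * (d :: real)"
proof -
  have "(1 - p * a) * z = K * y" using assms(1) by (simp add: algebra_simps)
  then have "(1 - p * m) * ((1 - p * a) * z) = (1 - p * m) * (K * y)" by simp
  also have "\<dots> = K * (y - m * (p * y))" by (simp add: algebra_simps)
  also have "y - m * (p * y) = s * x * (p * z) - s * d" using assms(2) by linarith
  finally show ?thesis by (simp add: algebra_simps)
qed

text \<open>A nonpositive fixed point of the monotone recursion stays below the iterates started at
  0, and a decreasing sequence bounded below converges.\<close>

lemma convergent_pi_gap: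
  assumes "valid_params P" "0 \<le> p" "p \<le> 1" "d \<ge> 0" "F_L P p > 0"
  shows "convergent (pi_gap P p d)"
proof -
  note v = assms(1)[unfolded valid_params_def]
  have K: "KK P > 0" by (rule KK_pos[OF assms(1)])
  \<comment> \<open>The inflation component of the fixed point; \<open>F_L P p > 0\<close> makes it
    nonpositive. The next line solves the Phillips curve for consumption.\<close>
  define z where "z = - KK P * sigm P * d / F_L P p"
  define y where "y = (1 - p * beta P * mpipi P) * z / KK P"
  have z: "z \<le> 0" using K v assms by (simp add: z_def)
  have "p * beta P * mpipi P \<le> 1"
    using v assms by (intro mult_le_one mult_nonneg_nonneg) auto
  then have y: "y \<le> 0" using z K by (simp add: y_def divide_nonpos_pos mult_nonneg_nonpos)
  have Ky: "KK P * y = (1 - p * beta P * mpipi P) * z" using K by (simp add: y_def)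
  have "F_L P p * z = - KK P * sigm P * d" using assms(5) by (simp add: z_def)
  moreover have "F_L P p * z
      = (1 - p * mxx P) * ((1 - p * beta P * mpipi P) * z) - p * sigm P * KK P * mxpi P * z"
    by (simp add: F_L_def algebra_simps)
  moreover have "(1 - p * mxx P) * ((1 - p * beta P * mpipi P) * z) = KK P * ((1 - p * mxx P) * y)"
    unfolding Ky[symmetric] by simp
  ultimately have "KK P * ((1 - p * mxx P) * y) = KK P * (sigm P * mxpi P * (p * z) - sigm P * d)"
    by (simp add: right_diff_distrib mult_ac)
  then have "(1 - p * mxx P) * y = sigm P * mxpi P * (p * z) - sigm P * d"
    using K by simp
  then have yfix: "y = mxx P * (p * y) + sigm P * mxpi P * (p * z) - sigm P * d"
    by (simp add: algebra_simps)
  have zfix: "z = mpipi P * beta P * (p * z) + KK P * y"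
    using Ky by (simp add: algebra_simps)
  have bound: "y \<le> c_gap P p d j \<and> z \<le> pi_gap P p d j" for j
  proof (induction j)
    case 0
    then show ?case using y z by simp
  next
    case (Suc j)
    have c: "y \<le> c_gap P p d (Suc j)"
      unfolding c_gap.simps using Suc v assms
      \<comment> \<open>Expanding \<open>y\<close> by its own equation turns both sides into the
        same monotone map.\<close>
      by (subst yfix) (intro diff_right_mono add_mono mult_left_mono, auto)
    have "z \<le> pi_gap P p d (Suc j)"
      unfolding pi_gap_Suc_c_gap using Suc c v assms K
      by (subst zfix) (intro add_mono mult_left_mono, auto)
    with c show ?case by blast
  qed
  have "decseq (pi_gap P p d)"
    using gap_Suc_le[OF assms(1,2,4)] by (auto intro: decseq_SucI simp del: pi_gap.simps)
  then obtain L where "pi_gap P p d \<longlonglongrightarrow> L"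
    using decseq_convergent[of "pi_gap P p d" z] bound by blast
  then show ?thesis by (auto simp: convergent_def)
qed

text \<open>A lower bound would yield a limit \<open>z \<le> 0\<close>, hence
  \<open>F_L P p * z \<ge> 0\<close>, whereas the fixed-point equation makes this product strictly
  negative for \<open>d > 0\<close>.\<close>

lemma pi_gap_at_bot:
  assumes "valid_params P" "0 \<le> p" "d > 0" "F_L P p \<le> 0"
  shows "filterlim (pi_gap P p d) at_bot sequentially"
proof -
  note v = assms(1)[unfolded valid_params_def]
  have K: "KK P > 0" by (rule KK_pos[OF assms(1)])
  have d: "d \<ge> 0" using assms by simp
  have dec: "decseq (pi_gap P p d)"
    using gap_Suc_le[OF assms(1,2) d] by (auto intro: decseq_SucI simp del: pi_gap.simps)
  have unbounded: "\<exists>j. pi_gap P p d j < B" for B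
  proof (rule ccontr)
    assume "\<nexists>j. pi_gap P p d j < B"
    then obtain z where z: "pi_gap P p d \<longlonglongrightarrow> z"
      using decseq_convergent[OF dec, of B] by (metis not_less)
    \<comment> \<open>Convergence of consumption is deduced from that of inflation by solving the
      Phillips curve for \<open>c_gap\<close>.\<close>
    define y where "y = (z - mpipi P * beta P * (p * z)) / KK P"
    have zS: "(\<lambda>j. pi_gap P p d (Suc j)) \<longlonglongrightarrow> z" using z by (rule LIMSEQ_Suc)
    have "(\<lambda>j. (pi_gap P p d (Suc j) - mpipi P * beta P * (p * pi_gap P p d j)) / KK P) \<longlonglongrightarrow> y"
      unfolding y_def using K by (intro tendsto_intros z zS) auto
    moreover have "(pi_gap P p d (Suc j) - mpipi P * beta P * (p * pi_gap P p d j)) / KK P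
        = c_gap P p d (Suc j)" for j
      unfolding pi_gap_Suc_c_gap using K by simp
    ultimately have yS: "(\<lambda>j. c_gap P p d (Suc j)) \<longlonglongrightarrow> y" by simp
    then have "c_gap P p d \<longlonglongrightarrow> y" by (rule LIMSEQ_imp_Suc)
    then have "(\<lambda>j. c_gap P p d (Suc j))
        \<longlonglongrightarrow> mxx P * (p * y) + sigm P * mxpi P * (p * z) - sigm P * d"
      unfolding c_gap.simps by (intro tendsto_intros z)
    then have y_eq: "y = mxx P * (p * y) + sigm P * mxpi P * (p * z) - sigm P * d"
      using yS LIMSEQ_unique by blast
    have z_eq: "z = mpipi P * beta P * (p * z) + KK P * y" using K by (simp add: y_def)
    have "F_L P p * z = - KK P * sigm P * d"
      using pi_gap_fixed_point[OF z_eq y_eq] by (simp add: F_L_def mult_ac)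
    also have "\<dots> < 0" using K v assms by simp
    finally have "F_L P p * z < 0" .
    moreover have "z \<le> 0"
      using z gap_nonpos(2)[OF assms(1,2) d] by (intro LIMSEQ_le_const2) auto
    ultimately show False using assms(4) by (simp add: mult_less_0_iff)
  qed
  show ?thesis unfolding filterlim_at_bot
  proof
    fix B
    obtain j where "pi_gap P p d j < B" using unbounded by blast
    then have "pi_gap P p d i \<le> B" if "i \<ge> j" for i using decseqD[OF dec that] by simp
    then show "eventually (\<lambda>i. pi_gap P p d i \<le> B) sequentially"
      by (auto simp: eventually_sequentially)
  qed
qed

theorem proposition6:
  fixes P :: nk_params and dmax cu piu p :: real
  assumes "valid_params P"
    and "dmax > 0"
    and "unintended_ss P cu piu"
    and "p \<in> {0..1}"
  shows "(\<forall>d\<in>{0..dmax}. \<forall>l\<ge>1.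
            \<exists>c infl. equilibrium P cu piu p d l c infl \<and>
              (\<forall>c' infl'. equilibrium P cu piu p d l c' infl' \<longrightarrow>
                 (\<forall>n s. node l n s \<longrightarrow> c' n s = c n s \<and> infl' n s = infl n s)))
       \<and> (\<forall>d\<in>{0..dmax}. \<forall>l\<ge>1.
            \<not> (\<exists>c infl. equilibrium P cu piu p d l c infl \<and> type_N P l infl)
          \<and> \<not> (\<exists>c infl. equilibrium P cu piu p d l c infl \<and> type_S P l infl)
          \<and> (\<forall>c infl. equilibrium P cu piu p d l c infl \<longrightarrow> type_L P l infl))
       \<and> (\<forall>d\<in>{0<..dmax}. \<forall>c infl.
            (\<forall>l\<ge>1. equilibrium P cu piu p d l (c l) (infl l)) \<longrightarrow>
            (p < p_bar P \<longrightarrow> stable_solution infl) \<and> (\<not> p < p_bar P \<longrightarrow> unstable_solution infl))"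
proof (intro conjI ballI allI impI)
  have p: "0 \<le> p" "p \<le> 1" using assms(4) by auto
  note eq_iff = equilibrium_iff[OF assms(1,3,4)]
  {
    fix d :: real and l :: nat assume "d \<in> {0..dmax}"
    then have d: "d \<ge> 0" by simp
    define c infl :: process
      where "c = (\<lambda>n s. case s of Low \<Rightarrow> cu + c_gap P p d (l - n) | Absorbing \<Rightarrow> cu)"
        and "infl = (\<lambda>n s. case s of Low \<Rightarrow> piu + pi_gap P p d (l - n) | Absorbing \<Rightarrow> piu)"
    have "equilibrium P cu piu p d l c infl" unfolding eq_iff[OF d] by (simp add: c_def infl_def)
    moreover have "c' n s = c n s \<and> infl' n s = infl n s"
      if "equilibrium P cu piu p d l c' infl'" "node l n s" for c' infl' n s
      using that unfolding eq_iff[OF d] by (cases s) (simp_all add: c_def infl_def)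
    ultimately show "\<exists>c infl. equilibrium P cu piu p d l c infl \<and>
        (\<forall>c' infl'. equilibrium P cu piu p d l c' infl' \<longrightarrow>
          (\<forall>n s. node l n s \<longrightarrow> c' n s = c n s \<and> infl' n s = infl n s))"
      by blast
  }
  {
    fix d :: real and l :: nat assume "d \<in> {0..dmax}" and l: "1 \<le> l"
    then have d: "d \<ge> 0" by simp
    \<comment> \<open>Refutes type N at date 0, which is low as \<open>l \<ge> 1\<close>, and type S
      at \<open>Suc k\<close>, which is low as \<open>k + 2 \<le> l\<close>.\<close>
    have below: "infl n Low \<le> pi_bar P"
      if "equilibrium P cu piu p d l c infl" "n < l" for c infl n
    proof -
      have "infl n Low \<le> piu"
        using that gap_nonpos(2)[OF assms(1) p(1) d] unfolding eq_iff[OF d] by simp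
      then show ?thesis using unintended_ss_ex1(2)[OF assms(1,3)] by simp
    qed
    show "type_L P l infl" if "equilibrium P cu piu p d l c infl" for c infl
      using below[OF that] by (simp add: type_L_def)
    show "\<not> (\<exists>c infl. equilibrium P cu piu p d l c infl \<and> type_N P l infl)"
      using below[of _ _ 0] l unfolding type_N_def by (metis less_le_trans not_less zero_less_one)
    show "\<not> (\<exists>c infl. equilibrium P cu piu p d l c infl \<and> type_S P l infl)"
    proof
      assume "\<exists>c infl. equilibrium P cu piu p d l c infl \<and> type_S P l infl"
      then obtain c infl k where eq: "equilibrium P cu piu p d l c infl" and k: "k + 2 \<le> l"
        and above: "\<forall>n. k < n \<and> n < l \<longrightarrow> infl n Low > pi_bar P"
        by (auto simp: type_S_def)
      show False using below[OF eq, of "Suc k"] above k by (auto dest: spec[of _ "Suc k"])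
    qed
  }
  fix d :: real and c infl :: "nat \<Rightarrow> process"
  assume "d \<in> {0<..dmax}" and eq: "\<forall>l\<ge>1. equilibrium P cu piu p d l (c l) (infl l)"
  then have d: "d > 0" by simp
  have "infl l 0 Low = piu + pi_gap P p d l" if "l \<ge> 1" for l
    using eq that d by (simp add: eq_iff)
  \<comment> \<open>At date 0 the remaining horizon is \<open>l\<close>. The equality is only
    eventual, since nothing constrains the family at \<open>l = 0\<close>.\<close>
  then have ev: "eventually (\<lambda>l. piu + pi_gap P p d l = infl l 0 Low) sequentially"
    by (intro eventually_sequentiallyI[of 1]) simp
  show "stable_solution infl" if less: "p < p_bar P"
  proof -
    obtain z where "pi_gap P p d \<longlonglongrightarrow> z"
      using convergent_pi_gap[OF assms(1) p, of d] F_L_pos_iff[OF assms(1,4)] less d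
      by (auto simp: convergent_def)
    then have "(\<lambda>l. piu + pi_gap P p d l) \<longlonglongrightarrow> piu + z" by (intro tendsto_intros)
    then have "(\<lambda>l. infl l 0 Low) \<longlonglongrightarrow> piu + z" using ev by (rule Lim_transform_eventually)
    then show ?thesis by (auto simp: stable_solution_def)
  qed
  show "unstable_solution infl" if "\<not> p < p_bar P"
  proof -
    have "filterlim (pi_gap P p d) at_bot sequentially"
      using pi_gap_at_bot[OF assms(1) p(1) d] F_L_pos_iff[OF assms(1,4)] that by simp
    then have "filterlim (\<lambda>l. - pi_gap P p d l) at_top sequentially"
      by (simp add: filterlim_uminus_at_bot)
    then have "filterlim (\<lambda>l. - piu + - pi_gap P p d l) at_top sequentially"
      by (rule filterlim_tendsto_add_at_top[OF tendsto_const])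
    \<comment> \<open>The left side is minus initial inflation, hence at most its absolute
      value.\<close>
    moreover have "eventually (\<lambda>l. - piu + - pi_gap P p d l \<le> \<bar>infl l 0 Low\<bar>) sequentially"
      using ev by eventually_elim linarith
    ultimately show ?thesis
      unfolding unstable_solution_def by (rule filterlim_at_top_mono)
  qed
qed

end
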